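(* Let $\mu>0$, $L_{\rm c}>0$, $b_1,b_2,b_3>0$, $h>0$, let $\omega\subset\mathbb{R}^2$ be a bounded domain with Lipschitz boundary, $\Omega_1=\omega\times[-\frac12,\frac12]$, and let $y_0$, $n_0$, $\Theta$, $(\mathrm{D}_x\Theta)^\natural(\eta_3)$ and $\mathrm{A}_{y_0}$ be as in the context. Let $\overline{Q}_{e,h}^\natural:\Omega_1\to\mathrm{SO}(3)$ be a microrotation field with first order partial derivatives and put $$\mathcal{K}_{\overline{Q}_{e,h}^\natural}:=\Big(\mathrm{axl}(\overline{Q}_{e,h}^{\natural,T}\partial_{\eta_1}\overline{Q}_{e,h}^\natural)\,\big|\,\mathrm{axl}(\overline{Q}_{e,h}^{\natural,T}\partial_{\eta_2}\overline{Q}_{e,h}^\natural)\,\big|\,0\Big)[(\mathrm{D}_x\Theta)^\natural(\eta_3)]^{-1}.$$ Consider the (pointwise) optimization problem $$\widetilde{W}^{{\rm hom},\natural}_{\rm curv}(\mathcal{K}_{\overline{Q}_{e,h}^\natural}):=\inf_{A\in\mathfrak{so}(3)}\widetilde{W}_{\rm curv}\Big(\big(\mathrm{axl}(\overline{Q}_{e,h}^{\natural,T}\partial_{\eta_1}\overline{Q}_{e,h}^\natural)\,\big|\,\mathrm{axl}(\overline{Q}_{e,h}^{\natural,T}\partial_{\eta_2}\overline{Q}_{e,h}^\natural)\,\big|\,\mathrm{axl}(A)\big)[(\mathrm{D}_x\Theta)^\natural(\eta_3)]^{-1}\Big).$$ Its solution $A^*\in\mathfrak{so}(3)$ is given by $\mathrm{axl}(A^*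 )=c^*$ with $$c^*=\frac{b_2-b_1}{b_1+b_2}\,\mathcal{K}_{\overline{Q}_{e,h}^\natural}^T n_0-\frac{2b_3}{2(b_1+b_3)}\,\mathrm{tr}(\mathcal{K}_{\overline{Q}_{e,h}^\natural})\,n_0,$$ and the corresponding homogenized curvature energy is $$\widetilde{W}^{{\rm hom},\natural}_{\rm curv}(\mathcal{K}_{\overline{Q}_{e,h}^\natural})=\mu L_{\rm c}^2\Big(b_1\|\mathrm{sym}\,\mathcal{K}_{\overline{Q}_{e,h}^\natural}^\parallel\|^2+b_2\|\mathrm{skew}\,\mathcal{K}_{\overline{Q}_{e,h}^\natural}^\parallel\|^2+\frac{b_1b_3}{b_1+b_3}\big[\mathrm{tr}(\mathcal{K}_{\overline{Q}_{e,h}^\natural}^\parallel)\big]^2+\frac{2b_1b_2}{b_1+b_2}\|\mathcal{K}_{\overline{Q}_{e,h}^\natural}^\perp\|^2\Big),$$ where $\mathcal{K}_{\overline{Q}_{e,h}^\natural}^\parallel=\mathrm{A}_{y_0}\mathcal{K}_{\overline{Q}_{e,h}^\natural}$ and $\mathcal{K}_{\overline{Q}_{e,h}^\natural}^\perp=(\mathbb{1}_3-\mathrm{A}_{y_0})\mathcal{K}_{\overline{Q}_{e,h}^\natural}$ are the parts of the orthogonal decomposition of $\mathcal{K}_{\overline{Q}_{e,h}^\natural}$ in the tangential plane and in the normal direction, respectively.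
   Context: $\mathfrak{so}(3)$ is the space of skew-symmetric real $3\times3$ matrices; $\mathrm{axl}(A)\in\mathbb{R}^3$ is the axial vector of $A\in\mathfrak{so}(3)$, i.e. $Av=\mathrm{axl}(A)\times v$ for all $v\in\mathbb{R}^3$. $(z_1|z_2|z_3)$ denotes the matrix obtained by placing $z_1,z_2,z_3$ side by side as columns (or blocks). $\mathrm{sym}X=\frac12(X+X^T)$, $\mathrm{skew}X=\frac12(X-X^T)$, $\|X\|^2=\mathrm{tr}(XX^T)$, $\mathbb{1}_3$ is the identity matrix. Curvature energy: for $\Gamma\in\mathbb{R}^{3\times3}$, $\widetilde{W}_{\rm curv}(\Gamma)=\mu L_{\rm c}^2\big(b_1\|\mathrm{sym}\,\Gamma\|^2+b_2\|\mathrm{skew}\,\Gamma\|^2+b_3[\mathrm{tr}(\Gamma)]^2\big)$. Geometry: $y_0:\omega\to\mathbb{R}^3$ is a $C^2$ function with unit normal field $n_0=\frac{\partial_{x_1}y_0\times\partial_{x_2}y_0}{\|\partial_{x_1}y_0\times\partial_{x_2}y_0\|}$, and $\Theta(x_1,x_2,x_3)=y_0(x_1,x_2)+x_3\,n_0(x_1,x_2)$ is assumed to be a $C^1$-diffeomorphism describing the curved shell of thickness $h$, so that for $|x_3|\le h/2$ the matrix $\mathrm{D}_x\Theta(x_3)=(\mathrm{D}y_0|n_0)+x_3(\mathrm{D}n_0|0)$ is invertible; $\mathrm{D}_x\Theta(0)=(\mathrm{D}y_0|n_0)$. Under the scaling $(\eta_1,\eta_2,\eta_3)\mapsto(\eta_1,\eta_2,h\eta_3)=(x_1,x_2,x_3)$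 one writes $(\mathrm{D}_x\Theta)^\natural(\eta_3):=\mathrm{D}_x\Theta(\eta_1,\eta_2,h\eta_3)$. Finally $\mathrm{A}_{y_0}:=(\mathrm{D}y_0|0)[\mathrm{D}_x\Theta(0)]^{-1}\in\mathbb{R}^{3\times3}$. All expressions are evaluated pointwise in $\Omega_1$ (with $y_0,n_0,\mathrm{A}_{y_0}$ evaluated at $(\eta_1,\eta_2)$), wherever the derivatives of $\overline{Q}_{e,h}^\natural$ exist. *)

theory Defs
  imports "HOL-Analysis.Analysis"
begin

subsection \<open>Matrices\<close>

definition cols3 :: "real^3 \<Rightarrow> real^3 \<Rightarrow> real^3 \<Rightarrow> real^3^3" where
  "cols3 z1 z2 z3 = transpose (vector [z1, z2, z3])"

definition so3 :: "(real^3^3) set" where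
  "so3 = {A. transpose A = - A}"

definition axl :: "real^3^3 \<Rightarrow> real^3" where
  "axl A = (THE a. \<forall>v. A *v v = cross3 a v)"

definition sym_part :: "real^3^3 \<Rightarrow> real^3^3" where
  "sym_part X = (1/2) *\<^sub>R (X + transpose X)"

definition skew_part :: "real^3^3 \<Rightarrow> real^3^3" where
  "skew_part X = (1/2) *\<^sub>R (X - transpose X)"

text \<open>The library norm on \<^typ>\<open>real^3^3\<close> is the Frobenius norm.\<close>

lemma norm_sq_eq_trace: "(norm X)\<^sup>2 = trace (X ** transpose X)" for X :: "real^3^3"
  by (simp add: power2_norm_eq_inner inner_vec_def trace_def matrix_matrix_mult_def transpose_def)

definition W_curv :: "real \<Rightarrow> real \<Rightarrow> real \<Rightarrow> real \<Rightarrow> real \<Rightarrow> real^3^3 \<Rightarrow> real" where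
  "W_curv \<mu> Lc b1 b2 b3 \<Gamma> =
     \<mu> * Lc\<^sup>2 * (b1 * (norm (sym_part \<Gamma>))\<^sup>2 + b2 * (norm (skew_part \<Gamma>))\<^sup>2 + b3 * (trace \<Gamma>)\<^sup>2)"


subsection \<open>Regularity of maps and domains\<close>

definition C1_on :: "'a::real_normed_vector set \<Rightarrow> ('a \<Rightarrow> 'b::real_normed_vector) \<Rightarrow> bool" where
  "C1_on S f \<longleftrightarrow> (\<exists>f' :: 'a \<Rightarrow> 'a \<Rightarrow>\<^sub>L 'b.
     (\<forall>x\<in>S. (f has_derivative blinfun_apply (f' x)) (at x within S)) \<and> continuous_on S f')"

definition C2_on :: "'a::real_normed_vector set \<Rightarrow> ('a \<Rightarrow> 'b::real_normed_vector) \<Rightarrow> bool" where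
  "C2_on S f \<longleftrightarrow> (\<exists>f' :: 'a \<Rightarrow> 'a \<Rightarrow>\<^sub>L 'b.
     (\<forall>x\<in>S. (f has_derivative blinfun_apply (f' x)) (at x within S)) \<and> C1_on S f')"

definition C1_diffeomorphism_on ::
    "'a::real_normed_vector set \<Rightarrow> ('a \<Rightarrow> 'b::real_normed_vector) \<Rightarrow> bool" where
  "C1_diffeomorphism_on S f \<longleftrightarrow> inj_on f S \<and> C1_on S f \<and> C1_on (f ` S) (inv_into S f)"

definition partial_deriv :: "'n::finite \<Rightarrow> (real^'n \<Rightarrow> 'b::real_normed_vector) \<Rightarrow> real^'n \<Rightarrow> 'b" where
  "partial_deriv i f x = vector_derivative (\<lambda>t. f (x + t *\<^sub>R axis i 1)) (at 0)"

definition has_partial_deriv :: "'n::finite \<Rightarrow> (real^'n \<Rightarrow> 'b::real_normed_vector) \<Rightarrow> real^'n \<Rightarrow> bool" where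
  "has_partial_deriv i f x \<longleftrightarrow> (\<lambda>t. f (x + t *\<^sub>R axis i 1)) differentiable (at 0)"

text \<open>Near each boundary point, in suitable orthonormal coordinates, the domain is the strict
  epigraph of a Lipschitz function; it thus lies on one side of its boundary.\<close>

definition bounded_Lipschitz_domain :: "(real^2) set \<Rightarrow> bool" where
  "bounded_Lipschitz_domain \<omega> \<longleftrightarrow>
     open \<omega> \<and> connected \<omega> \<and> \<omega> \<noteq> {} \<and> bounded \<omega> \<and>
     (\<forall>p\<in>frontier \<omega>. \<exists>U u v. \<exists>g :: real \<Rightarrow> real. \<exists>L.
        open U \<and> p \<in> U \<and> norm u = 1 \<and> norm v = 1 \<and> u \<bullet> v = 0 \<and> L-lipschitz_on UNIV g \<and>
        \<omega> \<inter> U = {x \<in> U. g (x \<bullet> u) < x \<bullet> v})"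


subsection \<open>Shell geometry\<close>

definition proj12 :: "real^3 \<Rightarrow> real^2" where
  "proj12 x = vector [x$1, x$2]"

text \<open>\<open>\<omega> \<times> [-h/2, h/2]\<close>; the case \<open>h = 1\<close> is the rescaled reference domain \<open>\<Omega>\<^sub>1\<close>.\<close>

definition slab :: "(real^2) set \<Rightarrow> real \<Rightarrow> (real^3) set" where
  "slab \<omega> h = {x. proj12 x \<in> \<omega> \<and> x$3 \<in> {-h/2..h/2}}"

definition unit_normal :: "(real^2 \<Rightarrow> real^3) \<Rightarrow> real^2 \<Rightarrow> real^3" where
  "unit_normal y0 x =
     (let m = cross3 (partial_deriv 1 y0 x) (partial_deriv 2 y0 x) in m /\<^sub>R norm m)"

definition Theta :: "(real^2 \<Rightarrow> real^3) \<Rightarrow> real^3 \<Rightarrow> real^3" where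
  "Theta y0 x = y0 (proj12 x) + x$3 *\<^sub>R unit_normal y0 (proj12 x)"

text \<open>The formula for \<^const>\<open>Theta\<close> makes sense for every value of the third coordinate, so the
  Jacobian below is a two-sided one also on the faces \<open>x\<^sub>3 = \<plusminus>h/2\<close> of the shell.\<close>

definition D_Theta :: "(real^2 \<Rightarrow> real^3) \<Rightarrow> real^3 \<Rightarrow> real^3^3" where
  "D_Theta y0 x = jacobian (Theta y0) (at x)"

definition D_Theta_nat :: "(real^2 \<Rightarrow> real^3) \<Rightarrow> real \<Rightarrow> real^3 \<Rightarrow> real^3^3" where
  "D_Theta_nat y0 h \<eta> = D_Theta y0 (vector [\<eta>$1, \<eta>$2, h * \<eta>$3])"

definition A_y0 :: "(real^2 \<Rightarrow> real^3) \<Rightarrow> real^2 \<Rightarrow> real^3^3" where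
  "A_y0 y0 x = cols3 (partial_deriv 1 y0 x) (partial_deriv 2 y0 x) 0 **
     matrix_inv (D_Theta y0 (vector [x$1, x$2, 0]))"


subsection \<open>Curvature tensor and homogenized energy\<close>

definition curv_with_column ::
    "(real^2 \<Rightarrow> real^3) \<Rightarrow> real \<Rightarrow> (real^3 \<Rightarrow> real^3^3) \<Rightarrow> real^3 \<Rightarrow> real^3 \<Rightarrow> real^3^3" where
  "curv_with_column y0 h Q \<eta> c =
     cols3 (axl (transpose (Q \<eta>) ** partial_deriv 1 Q \<eta>))
           (axl (transpose (Q \<eta>) ** partial_deriv 2 Q \<eta>)) c **
     matrix_inv (D_Theta_nat y0 h \<eta>)"

definition K_curv ::
    "(real^2 \<Rightarrow> real^3) \<Rightarrow> real \<Rightarrow> (real^3 \<Rightarrow> real^3^3) \<Rightarrow> real^3 \<Rightarrow> real^3^3" where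
  "K_curv y0 h Q \<eta> = curv_with_column y0 h Q \<eta> 0"

definition K_par ::
    "(real^2 \<Rightarrow> real^3) \<Rightarrow> real \<Rightarrow> (real^3 \<Rightarrow> real^3^3) \<Rightarrow> real^3 \<Rightarrow> real^3^3" where
  "K_par y0 h Q \<eta> = A_y0 y0 (proj12 \<eta>) ** K_curv y0 h Q \<eta>"

definition K_perp ::
    "(real^2 \<Rightarrow> real^3) \<Rightarrow> real \<Rightarrow> (real^3 \<Rightarrow> real^3^3) \<Rightarrow> real^3 \<Rightarrow> real^3^3" where
  "K_perp y0 h Q \<eta> = (mat 1 - A_y0 y0 (proj12 \<eta>)) ** K_curv y0 h Q \<eta>"

definition hom_objective ::
    "real \<Rightarrow> real \<Rightarrow> real \<Rightarrow> real \<Rightarrow> real \<Rightarrow> (real^2 \<Rightarrow> real^3) \<Rightarrow> real \<Rightarrow> (real^3 \<Rightarrow> real^3^3) \<Rightarrow> real^3 \<Rightarrow>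
     real^3^3 \<Rightarrow> real" where
  "hom_objective \<mu> Lc b1 b2 b3 y0 h Q \<eta> A =
     W_curv \<mu> Lc b1 b2 b3 (curv_with_column y0 h Q \<eta> (axl A))"

text \<open>The infimum is a function of \<^const>\<open>K_curv\<close> for fixed geometry, since \<^const>\<open>K_curv\<close> determines
  the first two columns in \<^const>\<open>curv_with_column\<close>.\<close>

definition W_curv_hom ::
    "real \<Rightarrow> real \<Rightarrow> real \<Rightarrow> real \<Rightarrow> real \<Rightarrow> (real^2 \<Rightarrow> real^3) \<Rightarrow> real \<Rightarrow> (real^3 \<Rightarrow> real^3^3) \<Rightarrow> real^3 \<Rightarrow>
     real" where
  "W_curv_hom \<mu> Lc b1 b2 b3 y0 h Q \<eta> = (INF A\<in>so3. hom_objective \<mu> Lc b1 b2 b3 y0 h Q \<eta> A)"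

end

theory Submission
  imports Defs
begin

text \<open>The matrix \<open>D\<Theta>\<close> at a point of the shell has columns of a special shape: the third one is the
unit normal \<open>n\<close> of the middle surface, and the first two are orthogonal to \<open>n\<close>. Writing \<open>e\<^sub>3\<close> for
the third coordinate vector and \<open>F\<close> for the matrix, this says \<open>F e\<^sub>3 = n\<close> and \<open>F\<^sup>T n = e\<^sub>3\<close>, and for
the inverse \<open>F\<^sup>-\<^sup>1 n = e\<^sub>3\<close> and \<open>F\<^sup>-\<^sup>T e\<^sub>3 = n\<close>
(\<open>D_Theta_frame\<close>, \<open>D_Theta_invertible\<close>, \<open>frame_inverse\<close>). The geometry enters the theorem
through these relations and their two consequences. A third column \<open>c\<close> in the curvature tensor adds
to \<open>K\<close> the rank-one matrix \<open>c n\<^sup>T\<close>, while \<open>K n = 0\<close> (\<open>curv_with_column_update\<close>); and the matrix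
\<open>A_y0\<close> is the orthogonal projection \<open>1 - n n\<^sup>T\<close> onto the tangent plane
(\<open>tangential_projection\<close>).

What remains is to minimise a quadratic polynomial in \<open>c\<close>. Put \<open>k = K\<^sup>T n\<close>, which is tangential.
The squared norm of a matrix, its inner product with its transpose, and its trace change under the
rank-one update by terms that involve only \<open>c \<bullet> c\<close>, \<open>c \<bullet> k\<close> and \<open>c \<bullet> n\<close>
(\<open>rank_one_update\<close>). The tangential part \<open>u\<close> of \<open>c\<close> meets the energy only through
\<open>b1/2 |k + u|\<^sup>2 + b2/2 |k - u|\<^sup>2\<close> and the normal component \<open>g = c \<bullet> n\<close> only through
\<open>b1 g\<^sup>2 + b3 (tr K + g)\<^sup>2\<close>. Completing both squares (\<open>W_curv_completed_square\<close>) exhibits the energy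
as the claimed minimum plus a positive definite quadratic form in the distance of \<open>c\<close> to the claimed
minimiser. Since every vector is the axial vector of exactly one skew-symmetric matrix
(\<open>axl_bij\<close>), minimising over these matrices is the same as minimising over \<open>c\<close>.\<close>

unbundle cross3_syntax

section \<open>Dyads\<close>

definition dyad :: "real^'m \<Rightarrow> real^'n \<Rightarrow> real^'n^'m" where
  "dyad a b = (\<chi> i j. a $ i * b $ j)"

lemma dyad_vec [simp]: "dyad a b *v v = (b \<bullet> v) *\<^sub>R a"
  by (simp add: vec_eq_iff dyad_def matrix_vector_mult_def inner_vec_def sum_distrib_left
      sum_distrib_right mult_ac)

lemma transpose_dyad: "transpose (dyad a b) = dyad b a"
  by (simp add: vec_eq_iff dyad_def transpose_def mult_ac)

lemma dyad_matrix_mult: "dyad a b ** M = dyad a (transpose M *v b)"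
  by (simp add: vec_eq_iff dyad_def matrix_vector_mult_def matrix_matrix_mult_def transpose_def
      sum_distrib_left mult_ac)

lemma trace_dyad: "trace (dyad a b) = a \<bullet> b"
  by (simp add: trace_def dyad_def inner_vec_def)

lemma inner_dyad: "M \<bullet> dyad a b = a \<bullet> (M *v b)"
  by (simp add: dyad_def inner_vec_def matrix_vector_mult_def sum_distrib_left mult_ac)

lemma inner_transpose: "transpose A \<bullet> transpose B = A \<bullet> (B :: real^'n^'m)"
  unfolding inner_vec_def transpose_def by (simp, rule sum.swap)

lemma transpose_add: "transpose (A + B) = transpose A + transpose (B :: real^'n^'m)"
  by (simp add: vec_eq_iff transpose_def)

lemma transpose_diff: "transpose (A - B) = transpose A - transpose (B :: real^'n^'m)"
  by (simp add: vec_eq_iff transpose_def)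

section \<open>The energy under a rank-one update\<close>

lemma sym_skew_norm:
  shows "(norm (sym_part X))\<^sup>2 = ((norm X)\<^sup>2 + X \<bullet> transpose X) / 2"
    and "(norm (skew_part X))\<^sup>2 = ((norm X)\<^sup>2 - X \<bullet> transpose X) / 2"
  using inner_transpose[of X X]
  by (simp_all add: sym_part_def skew_part_def power2_norm_eq_inner inner_add_left inner_add_right
      inner_diff_left inner_diff_right inner_commute field_simps)

text \<open>With the symmetric and skew parts eliminated, adding a dyad to the argument produces only inner
  products with dyads, and those reduce to inner products of vectors.\<close>

lemma W_curv_expand: "W_curv \<mu> Lc b1 b2 b3 X = \<mu> * Lc\<^sup>2 * ((b1 + b2) / 2 * (norm X)\<^sup>2
     + (b1 - b2) / 2 * (X \<bullet> transpose X) + b3 * (trace X)\<^sup>2)"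
  unfolding W_curv_def sym_skew_norm by (simp add: field_simps)

text \<open>Since \<open>K n = 0\<close>, the rows of \<open>K\<close> are orthogonal to those of \<open>c n\<^sup>T\<close>, so no term linear in \<open>c\<close>
  enters the norm. The tangential part of \<open>c\<close> meets \<open>K\<close> only in the product with the transpose.\<close>

lemma rank_one_update:
  fixes K :: "real^3^3"
  assumes "norm n = 1" "K *v n = 0"
  shows "(norm (K + dyad c n))\<^sup>2 = (norm K)\<^sup>2 + (norm c)\<^sup>2"
    and "(K + dyad c n) \<bullet> transpose (K + dyad c n) =
      K \<bullet> transpose K + 2 * (c \<bullet> (transpose K *v n)) + (c \<bullet> n)\<^sup>2"
    and "trace (K + dyad c n) = trace K + c \<bullet> n"
proof -
  have n: "n \<bullet> n = 1" using assms(1) by (simp add: norm_eq_1)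
  have d: "dyad c n \<bullet> dyad c n = c \<bullet> c" "dyad c n \<bullet> dyad n c = (c \<bullet> n)\<^sup>2"
    by (simp_all add: inner_dyad n power2_eq_square inner_commute)
  have 1: "K \<bullet> dyad c n = 0" "K \<bullet> dyad n c = c \<bullet> (transpose K *v n)"
    "transpose K \<bullet> dyad c n = c \<bullet> (transpose K *v n)"
    using assms(2) inner_transpose[of K "dyad n c"] by (simp_all add: inner_dyad transpose_dyad)
  show "(norm (K + dyad c n))\<^sup>2 = (norm K)\<^sup>2 + (norm c)\<^sup>2"
    using 1 d by (simp add: power2_norm_eq_inner inner_add_left inner_add_right inner_commute)
  show "(K + dyad c n) \<bullet> transpose (K + dyad c n) =
      K \<bullet> transpose K + 2 * (c \<bullet> (transpose K *v n)) + (c \<bullet> n)\<^sup>2"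
    using 1 d by (simp add: transpose_add transpose_dyad inner_add_left inner_add_right inner_commute)
  show "trace (K + dyad c n) = trace K + c \<bullet> n"
    by (simp add: trace_add trace_dyad)
qed

definition optimal_column :: "real \<Rightarrow> real \<Rightarrow> real \<Rightarrow> real^3^3 \<Rightarrow> real^3 \<Rightarrow> real^3" where
  "optimal_column b1 b2 b3 K n = ((b2 - b1) / (b1 + b2)) *\<^sub>R (transpose K *v n)
     - ((2 * b3) / (2 * (b1 + b3)) * trace K) *\<^sub>R n"

text \<open>The completion of the square on the level of scalars. For a unit vector \<open>n\<close> with \<open>K n = 0\<close>
  it is meant for the values
  \<open>N = |K|\<^sup>2\<close>, \<open>C = |c|\<^sup>2\<close>, \<open>T = K \<bullet> K\<^sup>T\<close>, \<open>p = c \<bullet> K\<^sup>T n\<close>, \<open>g = c \<bullet> n\<close>, \<open>t = tr K\<close> and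
  \<open>k = |K\<^sup>T n|\<^sup>2\<close>. With \<open>d = c - \<alpha> K\<^sup>T n + \<beta> t n\<close>, the bracket in the third line of the right-hand side
  is \<open>|d|\<^sup>2 - (d \<bullet> n)\<^sup>2\<close>, and \<open>g + \<beta> t\<close> is \<open>d \<bullet> n\<close>.\<close>

lemma scalar_completion:
  fixes b1 b2 b3 :: real
  assumes "b1 > 0" "b2 > 0" "b3 > 0"
  defines "\<alpha> \<equiv> (b2 - b1) / (b1 + b2)" and "\<beta> \<equiv> b3 / (b1 + b3)"
  shows "(b1 + b2) / 2 * (N + C) + (b1 - b2) / 2 * (T + 2 * p + g\<^sup>2) + b3 * (t + g)\<^sup>2
    = (b1 + b2) / 2 * (N - k) + (b1 - b2) / 2 * T + (b1 * b3) / (b1 + b3) * t\<^sup>2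
      + (2 * b1 * b2) / (b1 + b2) * k
      + (b1 + b2) / 2 * (C + \<alpha>\<^sup>2 * k + \<beta>\<^sup>2 * t\<^sup>2 - 2 * \<alpha> * p + 2 * \<beta> * t * g - (g + \<beta> * t)\<^sup>2)
      + (b1 + b3) * (g + \<beta> * t)\<^sup>2"
proof -
  have a: "(b1 + b2) * \<alpha> = b2 - b1" and b: "(b1 + b3) * \<beta> = b3"
    using assms by simp_all
  have k: "(2 * b1 * b2) / (b1 + b2) = (b1 + b2) / 2 * (1 - \<alpha>\<^sup>2)"
  proof -
    have "(b1 + b2) * ((b1 + b2) * (1 - \<alpha>\<^sup>2)) = 4 * b1 * b2" using a by algebra
    then show ?thesis using assms(1,2) by (simp add: field_simps)
  qed
  have t: "(b1 * b3) / (b1 + b3) = b3 * (1 - \<beta>)"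
    unfolding \<beta>_def using assms(1,3) by (simp add: field_simps)
  have e1: "(b1 + b2) / 2 * (2 * \<alpha> * p) = (b2 - b1) * p" using a by simp
  have e2: "(b1 + b3) * (g + \<beta> * t)\<^sup>2 = (b1 + b3) * g\<^sup>2 + 2 * b3 * g * t + b3 * \<beta> * t\<^sup>2"
  proof -
    have "(b1 + b3) * (g + \<beta> * t)\<^sup>2 =
        (b1 + b3) * g\<^sup>2 + 2 * ((b1 + b3) * \<beta>) * g * t + ((b1 + b3) * \<beta>) * \<beta> * t\<^sup>2"
      by algebra
    then show ?thesis using b by simp
  qed
  have e3: "(b1 + b2) / 2 * (C + \<alpha>\<^sup>2 * k + \<beta>\<^sup>2 * t\<^sup>2 - 2 * \<alpha> * p + 2 * \<beta> * t * g - (g + \<beta> * t)\<^sup>2)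
    = (b1 + b2) / 2 * (C + \<alpha>\<^sup>2 * k  - g\<^sup>2) - (b2 - b1) * p"
    unfolding e1[symmetric] by (simp add: power2_eq_square algebra_simps)
  show ?thesis unfolding e2 e3 k t by (simp add: field_simps power2_eq_square)
qed

text \<open>Up to the factor \<open>\<mu> Lc\<^sup>2\<close>, the quadratic part of the energy as a function of the third column: weight
  \<open>(b1 + b2) / 2\<close> on the part of \<open>d\<close> tangential to the surface and \<open>b1 + b3\<close> on the normal part.\<close>

definition excess :: "real \<Rightarrow> real \<Rightarrow> real \<Rightarrow> real^3 \<Rightarrow> real^3 \<Rightarrow> real" where
  "excess b1 b2 b3 n d =
     (b1 + b2) / 2 * ((norm d)\<^sup>2 - (d \<bullet> n)\<^sup>2) + (b1 + b3) * (d \<bullet> n)\<^sup>2"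

text \<open>The first summand is free of \<open>c\<close> and is the homogenized energy once \<open>P\<close> is recognised as the
  tangential part \<open>(1 - n n\<^sup>T) K\<close> and \<open>dyad n (K\<^sup>T n)\<close> as the normal part \<open>n n\<^sup>T K\<close>.\<close>

lemma W_curv_completed_square:
  fixes K :: "real^3^3"
  assumes b: "b1 > 0" "b2 > 0" "b3 > 0" and n: "norm n = 1" and Kn: "K *v n = 0"
  defines "P \<equiv> K - dyad n (transpose K *v n)"
  shows "W_curv \<mu> Lc b1 b2 b3 (K + dyad c n) =
    \<mu> * Lc\<^sup>2 * (b1 * (norm (sym_part P))\<^sup>2 + b2 * (norm (skew_part P))\<^sup>2
        + (b1 * b3) / (b1 + b3) * (trace P)\<^sup>2
        + (2 * b1 * b2) / (b1 + b2) * (norm (dyad n (transpose K *v n)))\<^sup>2)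
    + \<mu> * Lc\<^sup>2 * excess b1 b2 b3 n (c - optimal_column b1 b2 b3 K n)"
proof -
  define k where "k = transpose K *v n"
  define \<alpha> where "\<alpha> = (b2 - b1) / (b1 + b2)"
  define \<beta> where "\<beta> = b3 / (b1 + b3)"
  have nn: "n \<bullet> n = 1" using n by (simp add: norm_eq_1)
  have kn: "k \<bullet> n = 0"
    unfolding k_def using dot_lmul_matrix[of n K n] Kn by (simp add: transpose_matrix_vector)
  have [simp]: "norm (dyad n k) = norm k"
    using n by (simp add: norm_eq_sqrt_inner inner_dyad nn)
  have K: "K \<bullet> dyad n k = k \<bullet> k" "K \<bullet> dyad k n = 0" "transpose K \<bullet> dyad n k = 0"
    using Kn inner_transpose[of K "dyad k n"]
    by (simp_all add: inner_dyad transpose_dyad k_def dot_lmul_matrix[symmetric] transpose_matrix_vector)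
  have P: "(norm P)\<^sup>2 = (norm K)\<^sup>2 - (norm k)\<^sup>2" "P \<bullet> transpose P = K \<bullet> transpose K" "trace P = trace K"
    using K nn kn unfolding P_def k_def[symmetric]
    by (simp_all add: power2_norm_eq_inner transpose_diff transpose_dyad inner_diff_left inner_diff_right
        inner_commute inner_dyad trace_sub trace_dyad)
  have o: "optimal_column b1 b2 b3 K n = \<alpha> *\<^sub>R k - (\<beta> * trace K) *\<^sub>R n"
    using mult_divide_mult_cancel_left[of "2::real" b3 "b1 + b3"]
    by (simp add: optimal_column_def \<alpha>_def \<beta>_def k_def)
  have d: "(norm (c - optimal_column b1 b2 b3 K n))\<^sup>2 =
      (norm c)\<^sup>2 + \<alpha>\<^sup>2 * (norm k)\<^sup>2 + \<beta>\<^sup>2 * (trace K)\<^sup>2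
      - 2 * \<alpha> * (c \<bullet> k) + 2 * \<beta> * trace K * (c \<bullet> n)"
    "(c - optimal_column b1 b2 b3 K n) \<bullet> n = c \<bullet> n + \<beta> * trace K"
    unfolding o power2_norm_eq_inner using nn kn
      inner_commute[of n k] inner_commute[of k c] inner_commute[of n c]
    by (simp_all add: inner_diff_left inner_diff_right power2_eq_square algebra_simps)
  show ?thesis
    unfolding W_curv_expand rank_one_update[OF n Kn] k_def[symmetric] excess_def d sym_skew_norm P
      scalar_completion[OF b, of "(norm K)\<^sup>2" "(norm c)\<^sup>2" "K \<bullet> transpose K" 
        "c \<bullet> k" "c \<bullet> n" "trace K" "(norm k)\<^sup>2"]
      \<alpha>_def[symmetric] \<beta>_def[symmetric]
    by (simp add: algebra_simps add_divide_distrib diff_divide_distrib)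
qed

lemma excess_zero [simp]: "excess b1 b2 b3 n 0 = 0"
  by (simp add: excess_def)

text \<open>By Cauchy-Schwarz both summands are nonnegative. The second one is positive unless \<open>d\<close> is
  tangential, and then the first one is positive.\<close>

lemma excess_pos:
  assumes "b1 > 0" "b2 > 0" "b3 > 0" "norm n = 1" "d \<noteq> 0"
  shows "excess b1 b2 b3 n d > 0"
proof -
  have "\<bar>d \<bullet> n\<bar> \<le> norm d"
    using Cauchy_Schwarz_ineq2[of d n] assms(4) by simp
  then have *: "(d \<bullet> n)\<^sup>2 \<le> (norm d)\<^sup>2"
    by (metis abs_le_square_iff abs_norm_cancel)
  show ?thesis
  proof (cases "d \<bullet> n = 0")
    case True
    then show ?thesis using assms by (simp add: excess_def)
  next
    case False
    then show ?thesis using assms * unfolding excess_def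
      by (intro add_nonneg_pos mult_nonneg_nonneg mult_pos_pos) auto
  qed
qed

section \<open>Axial vectors\<close>

lemma so3_cross:
  assumes "A \<in> so3"
  shows "A *v v = vector [A$3$2, A$1$3, A$2$1] \<times> v"
proof -
  have skew: "A $ j $ i = - A $ i $ j" for i j
  proof -
    have "transpose A $ i $ j = (- A) $ i $ j"
      using assms by (simp add: so3_def)
    then show ?thesis by (simp add: transpose_def)
  qed
  have d: "A $ i $ i = 0" for i
    using skew[of i i] by simp
  show ?thesis
    by (simp add: vec_eq_iff forall_3 matrix_vector_mult_def cross3_def sum_3 d
        skew[of 1 2] skew[of 2 3] skew[of 3 1])
qed

lemma cross_eqI:
  assumes "\<And>v. a \<times> v = b \<times> v"
  shows "a = b"
  using assms[of "axis 1 1"] assms[of "axis 2 1"]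
  by (simp add: vec_eq_iff forall_3 cross3_def axis_def)

lemma axl_unique: "(\<And>v. A *v v = a \<times> v) \<Longrightarrow> axl A = a"
  unfolding axl_def by (rule the_equality, blast, rule cross_eqI, simp)

lemma axl_bij: "bij_betw axl so3 UNIV"
proof (rule bij_betw_byWitness[where f' = "\<lambda>a. matrix ((\<times>) a)"])
  have m: "matrix ((\<times>) a) *v v = a \<times> v" for a v
    using bilinear_cross by (simp add: bilinear_def)
  show "\<forall>A\<in>so3. matrix ((\<times>) (axl A)) = A"
  proof
    fix A assume "A \<in> so3"
    then have v: "A *v v = axl A \<times> v" for v
      using axl_unique[OF so3_cross] so3_cross by simp
    show "matrix ((\<times>) (axl A)) = A"
      unfolding matrix_eq m v by simp
  qed
  show "\<forall>a\<in>UNIV. axl (matrix ((\<times>) a)) = a"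
    using axl_unique m by blast
  show "(\<lambda>a. matrix ((\<times>) a)) ` UNIV \<subseteq> so3"
    by (simp add: so3_def vec_eq_iff transpose_def matrix_def forall_3 cross3_def axis_def image_subset_iff)
qed auto

section \<open>The normal field and the Jacobian of the shell map\<close>

lemma partial_deriv_eq_derivative:
  assumes "(f has_derivative f') (at x)"
  shows "partial_deriv i f x = f' (axis i 1)"
proof -
  have "((\<lambda>t. x + t *\<^sub>R axis i 1) has_derivative (\<lambda>t. t *\<^sub>R axis i 1)) (at 0)"
    by (auto intro!: derivative_eq_intros)
  moreover have "(f has_derivative f') (at (x + 0 *\<^sub>R axis i 1))"
    using assms by simp
  ultimately have "((\<lambda>t. f (x + t *\<^sub>R axis i 1)) has_derivative (\<lambda>t. f' (t *\<^sub>R axis i 1))) (at 0)"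
    by (rule has_derivative_compose)
  moreover have "f' (t *\<^sub>R axis i 1) = t *\<^sub>R f' (axis i 1)" for t
    using has_derivative_linear[OF assms] by (rule linear_scale)
  ultimately show ?thesis
    unfolding partial_deriv_def by (intro vector_derivative_at) (simp add: has_vector_derivative_def)
qed

lemma partial_deriv_differentiable:
  assumes "open S" "C2_on S f" "x \<in> S"
  shows "f differentiable (at x)" and "partial_deriv i f differentiable (at x)"
proof -
  obtain f' where f': "\<And>x. x \<in> S \<Longrightarrow> (f has_derivative blinfun_apply (f' x)) (at x)"
    and "C1_on S f'"
    using assms unfolding C2_on_def by (metis at_within_open)
  then obtain f'' where f'': "(f' has_derivative f'') (at x)"
    using assms unfolding C1_on_def by (metis at_within_open)
  show "f differentiable (at x)"
    using f' assms(3) by (auto simp: differentiable_def)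
  have "((\<lambda>x. blinfun_apply (f' x) (axis i 1)) has_derivative
      (\<lambda>v. blinfun_apply (f'' v) (axis i 1))) (at x)"
    using f'' by (auto intro!: derivative_eq_intros)
  then have "(partial_deriv i f has_derivative (\<lambda>v. blinfun_apply (f'' v) (axis i 1))) (at x)"
    by (rule has_derivative_transform_within_open[OF _ assms(1,3)])
      (simp add: partial_deriv_eq_derivative[OF f'])
  then show "partial_deriv i f differentiable (at x)"
    by (auto simp: differentiable_def)
qed

lemma proj12_vector [simp]: "proj12 (vector [x $ 1, x $ 2, t]) = x"
  by (simp add: proj12_def vec_eq_iff forall_2)

lemma proj12_linear: "linear proj12"
  by (rule linearI) (simp_all add: proj12_def vec_eq_iff forall_2)

lemma proj12_axis [simp]:
  "proj12 (axis 1 1) = axis 1 1" "proj12 (axis 2 1) = axis 2 1" "proj12 (axis 3 1) = 0"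
  by (simp_all add: proj12_def vec_eq_iff forall_2 axis_def)

text \<open>Injectivity of the shell map already rules out degenerate points of the surface. Where the two
  tangent vectors are linearly dependent, the quotient that defines the unit normal is zero by the convention for
  division by zero, so the shell map would be constant along the fibre over that point.\<close>

lemma unit_normal_nonzero:
  assumes "inj_on (Theta y0) (slab \<omega> h)" "h > 0" "x \<in> \<omega>"
  shows "unit_normal y0 x \<noteq> 0"
proof
  assume 0: "unit_normal y0 x = 0"
  have "vector [x$1, x$2, 0] = (vector [x$1, x$2, h/2] :: real^3)"
  proof (rule inj_onD[OF assms(1)])
    show "Theta y0 (vector [x$1, x$2, 0]) = Theta y0 (vector [x$1, x$2, h/2])"
      using 0 by (simp add: Theta_def)
  qed (use assms in \<open>auto simp: slab_def\<close>)
  then have "(vector [x$1, x$2, 0] :: real^3) $ 3 = (vector [x$1, x$2, h/2] :: real^3) $ 3"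
    by simp
  then show False using \<open>h > 0\<close> by simp
qed

lemma unit_normal_properties:
  assumes "unit_normal y0 x \<noteq> 0"
  shows "norm (unit_normal y0 x) = 1"
    and "unit_normal y0 x \<bullet> partial_deriv 1 y0 x = 0"
    and "unit_normal y0 x \<bullet> partial_deriv 2 y0 x = 0"
  using assms by (auto simp: unit_normal_def Let_def dot_cross_self)

lemma unit_normal_differentiable:
  assumes "open \<omega>" "C2_on \<omega> y0" "x \<in> \<omega>" "unit_normal y0 x \<noteq> 0"
  shows "unit_normal y0 differentiable (at x)"
proof -
  define m where "m = (\<lambda>x. cross3 (partial_deriv 1 y0 x) (partial_deriv 2 y0 x))"
  have "bounded_bilinear cross3"
    using bilinear_cross bilinear_conv_bounded_bilinear by blast
  then have m: "m differentiable (at x)"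
    using partial_deriv_differentiable(2)[OF assms(1-3)]
    unfolding m_def differentiable_def by (blast intro: bounded_bilinear.FDERIV)
  have "m x \<noteq> 0"
    using assms(4) by (auto simp: unit_normal_def m_def)
  then have "(\<lambda>x. inverse (norm (m x)) *\<^sub>R m x) differentiable (at x)"
    using m by (intro differentiable_scaleR differentiable_inverse differentiable_compose[of norm m])
      auto
  then show ?thesis
    by (simp add: unit_normal_def[abs_def] m_def Let_def)
qed

text \<open>The slab admits small steps along every coordinate axis also from the points of its two faces.
  Hence derivatives within the slab are unique there, and the one-sided derivatives supplied by a
  diffeomorphism of the slab agree with the two-sided Jacobian.\<close>

lemma slab_directions:
  fixes \<xi> :: "real^3"
  assumes "open \<omega>" "h > 0" "\<xi> \<in> slab \<omega> h" "i \<in> Basis" "e > 0"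
  shows "\<exists>d. 0 < \<bar>d\<bar> \<and> \<bar>d\<bar> < e \<and> \<xi> + d *\<^sub>R i \<in> slab \<omega> h"
proof -
  obtain k where k: "i = axis k 1" using assms(4) by (auto simp: Basis_vec_def)
  have x: "proj12 \<xi> \<in> \<omega>" and s: "- h / 2 \<le> \<xi> $ 3" "\<xi> $ 3 \<le> h / 2"
    using assms(3) by (auto simp: slab_def)
  obtain r where r: "r > 0" "ball (proj12 \<xi>) r \<subseteq> \<omega>"
    using x assms(1) open_contains_ball by blast
  show ?thesis
  proof (cases "k = 3")
    case True
    \<comment> \<open>on a face of the slab only the step towards the middle surface stays inside\<close>
    define d where "d = (if \<xi> $ 3 > 0 then - min (e/2) (h/2) else min (e/2) (h/2))"
    have "0 < \<bar>d\<bar>" "\<bar>d\<bar> < e" "- h / 2 \<le> \<xi> $ 3 + d" "\<xi> $ 3 + d \<le> h / 2"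
      using assms(2,5) s by (auto simp: d_def min_def split: if_splits)
    then show ?thesis
      using x True k proj12_linear
      by (intro exI[of _ d]) (auto simp: slab_def linear_add linear_scale)
  next
    case False
    define d where "d = min (e/2) (r/2)"
    have n: "norm (proj12 i) = 1" and i3: "i $ 3 = 0"
      using False exhaust_3[of k] k by (auto simp: norm_axis_1, auto simp: axis_def)
    have "proj12 (\<xi> + d *\<^sub>R i) \<in> ball (proj12 \<xi>) r"
      using n assms(5) r(1)
      by (simp add: linear_add[OF proj12_linear] linear_scale[OF proj12_linear] dist_norm d_def)
    then have "\<xi> + d *\<^sub>R i \<in> slab \<omega> h"
      using r(2) s i3 by (auto simp: slab_def)
    then show ?thesis
      using assms(5) r(1) by (intro exI[of _ d]) (auto simp: d_def)
  qed
qed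

text \<open>The derivative of \<open>y0 + x\<^sub>3 n\<close> is \<open>D y0 + x\<^sub>3 D n\<close> in the surface directions and \<open>n\<close> in the
  transversal one. The third relation is orthogonality of the first two columns to \<open>n\<close>.
  It holds at every height because \<open>D n\<close> is itself tangential.\<close>

lemma D_Theta_frame:
  assumes "open \<omega>" "C2_on \<omega> y0" "proj12 \<xi> \<in> \<omega>"
    and nz: "\<forall>x\<in>\<omega>. unit_normal y0 x \<noteq> 0"
  defines "n \<equiv> unit_normal y0 (proj12 \<xi>)"
  shows "(Theta y0 has_derivative (*v) (D_Theta y0 \<xi>)) (at \<xi>)"
    and "D_Theta y0 \<xi> *v axis 3 1 = n"
    and "transpose (D_Theta y0 \<xi>) *v n = axis 3 1"
    and "\<xi> $ 3 = 0 \<Longrightarrow> D_Theta y0 \<xi> *v axis 1 1 = partial_deriv 1 y0 (proj12 \<xi>)"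
    and "\<xi> $ 3 = 0 \<Longrightarrow> D_Theta y0 \<xi> *v axis 2 1 = partial_deriv 2 y0 (proj12 \<xi>)"
proof -
  let ?x = "proj12 \<xi>"
  obtain y' where y': "(y0 has_derivative y') (at ?x)"
    using partial_deriv_differentiable(1)[OF assms(1-3)] by (auto simp: differentiable_def)
  obtain n' where n': "(unit_normal y0 has_derivative n') (at ?x)"
    using unit_normal_differentiable[OF assms(1-3) bspec[OF nz assms(3)]] by (auto simp: differentiable_def)
  have p: "(proj12 has_derivative proj12) (at \<xi>)"
    using proj12_linear by (simp add: linear_imp_has_derivative)
  have 3: "((\<lambda>\<xi>::real^3. \<xi> $ 3) has_derivative (\<lambda>v. v $ 3)) (at \<xi>)"
    by (simp add: bounded_linear_imp_has_derivative bounded_linear_vec_nth)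
  have T: "(Theta y0 has_derivative
      (\<lambda>v. y' (proj12 v) + (\<xi> $ 3 *\<^sub>R n' (proj12 v) + v $ 3 *\<^sub>R n))) (at \<xi>)"
    unfolding Theta_def[abs_def] n_def
    by (intro has_derivative_add has_derivative_scaleR 3
        has_derivative_compose[OF p y'] has_derivative_compose[OF p n'])
  then have "Theta y0 differentiable (at \<xi>)"
    by (rule differentiableI)
  then show D: "(Theta y0 has_derivative (*v) (D_Theta y0 \<xi>)) (at \<xi>)"
    unfolding D_Theta_def by (rule jacobian_works[THEN iffD1])
  have Dv: "D_Theta y0 \<xi> *v v = y' (proj12 v) + (\<xi> $ 3 *\<^sub>R n' (proj12 v) + v $ 3 *\<^sub>R n)" for v
    using fun_cong[OF has_derivative_unique[OF D T]] .
  have lin: "y' 0 = 0" "n' 0 = 0"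
    using has_derivative_linear[OF y'] has_derivative_linear[OF n'] by (simp_all add: linear_0)
  have n1: "norm n = 1"
    using unit_normal_properties(1) nz assms(3) by (simp add: n_def)
  then have nn: "n \<bullet> n = 1" by (simp add: norm_eq_1)
  \<comment> \<open>differentiating \<open>n \<bullet> n = 1\<close>: the derivative of the normal is tangential\<close>
  have tang: "n \<bullet> n' w = 0" for w
  proof -
    have "((\<lambda>x. unit_normal y0 x \<bullet> unit_normal y0 x) has_derivative (\<lambda>w. n \<bullet> n' w + n' w \<bullet> n)) (at ?x)"
      using has_derivative_inner[OF n' n'] by (simp add: n_def)
    then have "((\<lambda>x. 1) has_derivative (\<lambda>w. n \<bullet> n' w + n' w \<bullet> n)) (at ?x)"
      by (rule has_derivative_transform_within_open[OF _ assms(1,3)])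
        (use unit_normal_properties(1)[OF bspec[OF nz]] in \<open>simp add: norm_eq_1\<close>)
    then have "(\<lambda>w. n \<bullet> n' w + n' w \<bullet> n) = (\<lambda>w. 0)"
      using has_derivative_const has_derivative_unique by blast
    then show ?thesis by (metis add_cancel_right_left inner_commute mult_2 mult_eq_0_iff zero_neq_numeral)
  qed
  have y'_axis: "y' (axis i 1) = partial_deriv i y0 ?x" for i
    using partial_deriv_eq_derivative[OF y'] by simp
  have ny': "n \<bullet> y' (axis 1 1) = 0" "n \<bullet> y' (axis 2 1) = 0"
    using unit_normal_properties(2,3)[OF bspec[OF nz assms(3)]] by (simp_all add: y'_axis n_def)
  show "D_Theta y0 \<xi> *v axis 3 1 = n"
    by (simp add: Dv lin)
  show "\<xi> $ 3 = 0 \<Longrightarrow> D_Theta y0 \<xi> *v axis 1 1 = partial_deriv 1 y0 ?x"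
    "\<xi> $ 3 = 0 \<Longrightarrow> D_Theta y0 \<xi> *v axis 2 1 = partial_deriv 2 y0 ?x"
    by (simp_all add: Dv y'_axis) (simp_all add: axis_def)
  have c: "(n v* D_Theta y0 \<xi>) $ i = n \<bullet> (D_Theta y0 \<xi> *v axis i 1)" for i
    by (metis cart_eq_inner_axis dot_lmul_matrix)
  show "transpose (D_Theta y0 \<xi>) *v n = axis 3 1"
    by (simp add: vec_eq_iff forall_3 c Dv lin inner_add_right tang ny' nn) (simp add: axis_def)
qed

text \<open>The chain rule for the inverse map after the shell map gives a left inverse of the derivative
  within the slab.\<close>

lemma D_Theta_invertible:
  assumes "open \<omega>" "C2_on \<omega> y0" "h > 0" "C1_diffeomorphism_on (slab \<omega> h) (Theta y0)" "\<xi> \<in> slab \<omega> h"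
  shows "invertible (D_Theta y0 \<xi>)"
proof -
  let ?S = "slab \<omega> h" and ?G = "inv_into (slab \<omega> h) (Theta y0)"
  have inj: "inj_on (Theta y0) ?S" and "C1_on (Theta y0 ` ?S) ?G"
    using assms(4) by (auto simp: C1_diffeomorphism_on_def)
  then obtain G' where G': "(?G has_derivative G') (at (Theta y0 \<xi>) within Theta y0 ` ?S)"
    using assms(5) unfolding C1_on_def by blast
  have "proj12 \<xi> \<in> \<omega>" using assms(5) by (simp add: slab_def)
  then have D: "(Theta y0 has_derivative (*v) (D_Theta y0 \<xi>)) (at \<xi> within ?S)"
    using D_Theta_frame(1)[OF assms(1,2)] unit_normal_nonzero[OF inj assms(3)]
    by (blast intro: has_derivative_at_withinI)
  have "(?G \<circ> Theta y0 has_derivative G' \<circ> (*v) (D_Theta y0 \<xi>)) (at \<xi> within ?S)"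
    by (rule diff_chain_within[OF D G'])
  then have "((\<lambda>x. x) has_derivative G' \<circ> (*v) (D_Theta y0 \<xi>)) (at \<xi> within ?S)"
    by (rule has_derivative_transform[OF assms(5), rotated]) (use inj in simp)
  then have "G' \<circ> (*v) (D_Theta y0 \<xi>) = (\<lambda>x. x)"
    using has_derivative_ident slab_directions[OF assms(1,3,5)]
    by (rule frechet_derivative_unique_within)
  then have "matrix G' *v (D_Theta y0 \<xi> *v v) = v" for v
    using has_derivative_linear[OF G'] by (simp add: fun_eq_iff)
  then have "matrix G' ** D_Theta y0 \<xi> = mat 1"
    by (simp add: matrix_eq matrix_vector_mul_assoc)
  then show ?thesis using invertible_left_inverse by blast
qed

section \<open>The curvature tensor and the tangential projection\<close>

lemma frame_inverse:
  fixes F :: "real^3^3"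
  assumes "invertible F" "F *v axis 3 1 = n" "transpose F *v n = axis 3 1"
  shows "F ** matrix_inv F = mat 1"
    and "matrix_inv F *v n = axis 3 1"
    and "transpose (matrix_inv F) *v axis 3 1 = n"
proof -
  have "F ** matrix_inv F = mat 1 \<and> matrix_inv F ** F = mat 1"
    using assms(1) unfolding matrix_inv_def invertible_def by (rule someI_ex)
  then have r: "F ** matrix_inv F = mat 1" and l: "matrix_inv F ** F = mat 1"
    by simp_all
  show "F ** matrix_inv F = mat 1" by (rule r)
  show "matrix_inv F *v n = axis 3 1"
    unfolding assms(2)[symmetric] matrix_vector_mul_assoc l by simp
  show "transpose (matrix_inv F) *v axis 3 1 = n"
    unfolding assms(3)[symmetric] matrix_vector_mul_assoc matrix_transpose_mul[symmetric] r
    by (simp add: transpose_mat)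
qed

lemma matrix_mult_add_left: "(A + B) ** C = A ** C + B ** (C :: real^'k^'n)"
  by (simp add: vec_eq_iff matrix_matrix_mult_def sum.distrib algebra_simps)

lemma cols3_last_column: "cols3 a b c = cols3 a b 0 + dyad c (axis 3 1)"
  by (simp add: vec_eq_iff forall_3 cols3_def transpose_def dyad_def axis_def)

lemma cols3_vec: "cols3 a b c *v v = v $ 1 *\<^sub>R a + v $ 2 *\<^sub>R b + v $ 3 *\<^sub>R c"
  by (simp add: vec_eq_iff forall_3 cols3_def transpose_def matrix_vector_mult_def sum_3 mult_ac)

text \<open>The matrix \<open>(D y0 | 0)\<close> is \<open>F - n e\<^sub>3\<^sup>T\<close> for the Jacobian \<open>F\<close> on the middle surface, and
  \<open>e\<^sub>3\<^sup>T F\<^sup>-\<^sup>1 = n\<^sup>T\<close>.\<close>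

lemma tangential_projection:
  assumes "open \<omega>" "C2_on \<omega> y0" "h > 0" "C1_diffeomorphism_on (slab \<omega> h) (Theta y0)" "x \<in> \<omega>"
  shows "A_y0 y0 x = mat 1 - dyad (unit_normal y0 x) (unit_normal y0 x)"
proof -
  define \<xi> where "\<xi> = (vector [x $ 1, x $ 2, 0] :: real^3)"
  define n where "n = unit_normal y0 x"
  let ?F = "D_Theta y0 \<xi>"
  have p: "proj12 \<xi> = x" and \<xi>: "\<xi> \<in> slab \<omega> h" "\<xi> $ 3 = 0"
    using assms(3,5) by (simp_all add: \<xi>_def slab_def)
  have nz: "\<forall>x\<in>\<omega>. unit_normal y0 x \<noteq> 0"
    using unit_normal_nonzero assms(3,4) unfolding C1_diffeomorphism_on_def by blast
  note frame = D_Theta_frame[OF assms(1,2), of \<xi>, unfolded p, OF assms(5) nz, folded n_def]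
  note inv = frame_inverse[OF D_Theta_invertible[OF assms(1-4) \<xi>(1)] frame(2,3)]
  have "?F = cols3 (partial_deriv 1 y0 x) (partial_deriv 2 y0 x) n"
    using frame(2,4,5) \<xi>(2)
    by (simp add: matrix_vector_mult_basis vec_eq_iff forall_3 cols3_def transpose_def column_def)
  then have "mat 1 = A_y0 y0 x + dyad n (axis 3 1) ** matrix_inv ?F"
    using inv(1) unfolding A_y0_def \<xi>_def[symmetric] matrix_mult_add_left[symmetric]
    by (simp only: cols3_last_column[of _ _ n])
  then show ?thesis
    unfolding dyad_matrix_mult inv(3) n_def by simp
qed

text \<open>Although \<open>F\<close> is taken at height \<open>h \<eta>\<^sub>3\<close>, the relations \<open>F\<^sup>-\<^sup>T e\<^sub>3 = n\<close> and \<open>F\<^sup>-\<^sup>1 n = e\<^sub>3\<close> hold with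
  the normal of the middle surface. The first one turns \<open>c e\<^sub>3\<^sup>T F\<^sup>-\<^sup>1\<close> into \<open>c n\<^sup>T\<close>; by the second one
  \<open>K n\<close> is the third column of \<open>(a | b | 0)\<close>.\<close>

lemma curv_with_column_update:
  assumes "open \<omega>" "C2_on \<omega> y0" "h > 0" "C1_diffeomorphism_on (slab \<omega> h) (Theta y0)" "\<eta> \<in> slab \<omega> 1"
  defines "n \<equiv> unit_normal y0 (proj12 \<eta>)"
  shows "curv_with_column y0 h Q \<eta> c = K_curv y0 h Q \<eta> + dyad c n"
    and "K_curv y0 h Q \<eta> *v n = 0"
proof -
  define \<xi> where "\<xi> = (vector [\<eta> $ 1, \<eta> $ 2, h * \<eta> $ 3] :: real^3)"
  have p: "proj12 \<xi> = proj12 \<eta>"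
    by (simp add: \<xi>_def proj12_def)
  have x: "proj12 \<eta> \<in> \<omega>" and s: "- 1 \<le> 2 * \<eta> $ 3" "2 * \<eta> $ 3 \<le> 1"
    using assms(5) by (auto simp: slab_def)
  have "h * (- 1) \<le> h * (2 * \<eta> $ 3)" "h * (2 * \<eta> $ 3) \<le> h * 1"
    using s assms(3) by (intro mult_left_mono; simp)+
  then have \<xi>: "\<xi> \<in> slab \<omega> h"
    using x p by (simp add: slab_def) (simp add: \<xi>_def)
  have nz: "\<forall>x\<in>\<omega>. unit_normal y0 x \<noteq> 0"
    using unit_normal_nonzero assms(3,4) unfolding C1_diffeomorphism_on_def by blast
  note frame = D_Theta_frame[OF assms(1,2), of \<xi>, unfolded p, OF x nz, folded n_def]
  note inv = frame_inverse[OF D_Theta_invertible[OF assms(1-4) \<xi>] frame(2,3)]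
  have F: "D_Theta_nat y0 h \<eta> = D_Theta y0 \<xi>"
    by (simp add: D_Theta_nat_def \<xi>_def)
  show "curv_with_column y0 h Q \<eta> c = K_curv y0 h Q \<eta> + dyad c n"
    unfolding K_curv_def curv_with_column_def F cols3_last_column[of _ _ c]
      matrix_mult_add_left dyad_matrix_mult inv(3) ..
  show "K_curv y0 h Q \<eta> *v n = 0"
    unfolding K_curv_def curv_with_column_def F matrix_vector_mul_assoc[symmetric] inv(2) cols3_vec
    by (simp add: axis_def)
qed

section \<open>The minimisation problem\<close>

lemma arg_min_by_excess:
  fixes f :: "'a \<Rightarrow> real" and g :: "'a \<Rightarrow> 'b::group_add"
  assumes "bij_betw g S UNIV"
    and f: "\<And>A. f A = m + E (g A - c)" and E: "E 0 = 0" "\<And>d. d \<noteq> 0 \<Longrightarrow> E d > 0"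
  shows "\<exists>!A. is_arg_min f (\<lambda>A. A \<in> S) A"
    and "is_arg_min f (\<lambda>A. A \<in> S) A \<Longrightarrow> g A = c"
    and "(INF A\<in>S. f A) = m"
proof -
  obtain B where B: "B \<in> S" "g B = c"
    using assms(1) by (metis UNIV_I bij_betw_iff_bijections)
  have fB: "f B = m" using f B E(1) by simp
  have less: "m < f A" if "g A \<noteq> c" for A
    using f[of A] E(2)[of "g A - c"] that by simp
  have le: "m \<le> f A" for A
    using less[of A] f[of A] E(1) by (cases "g A = c") auto
  show c: "g A = c" if "is_arg_min f (\<lambda>A. A \<in> S) A" for A
    using that less[of A] B(1) fB by (auto simp: is_arg_min_def)
  show "\<exists>!A. is_arg_min f (\<lambda>A. A \<in> S) A"
  proof (rule ex1I)
    show "is_arg_min f (\<lambda>A. A \<in> S) B"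
      using B(1) le fB by (auto simp: is_arg_min_def not_less)
    show "A = B" if "is_arg_min f (\<lambda>A. A \<in> S) A" for A
      using that c[OF that] B assms(1) by (auto simp: is_arg_min_def bij_betw_def inj_on_def)
  qed
  show "(INF A\<in>S. f A) = m"
    using B(1) fB le by (intro cInf_eq_minimum) (auto intro: rev_image_eqI)
qed

theorem theorem4p2:
  fixes \<mu> Lc b1 b2 b3 h :: real
    and \<omega> :: "(real^2) set"
    and y0 :: "real^2 \<Rightarrow> real^3"
    and Q :: "real^3 \<Rightarrow> real^3^3"
    and \<eta> :: "real^3"
  defines "n0 \<equiv> unit_normal y0 (proj12 \<eta>)"
    and "K \<equiv> K_curv y0 h Q \<eta>"
    and "Kpar \<equiv> K_par y0 h Q \<eta>"
    and "Kperp \<equiv> K_perp y0 h Q \<eta>"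
  assumes "\<mu> > 0" and "Lc > 0" and "b1 > 0" and "b2 > 0" and "b3 > 0" and "h > 0"
    and "bounded_Lipschitz_domain \<omega>"
    and "C2_on \<omega> y0"
    and "C1_diffeomorphism_on (slab \<omega> h) (Theta y0)"
    and "\<forall>\<xi>\<in>slab \<omega> 1. rotation_matrix (Q \<xi>)"
    and "\<eta> \<in> slab \<omega> 1"
    and "has_partial_deriv 1 Q \<eta>" and "has_partial_deriv 2 Q \<eta>"
  shows "(\<exists>!A. is_arg_min (hom_objective \<mu> Lc b1 b2 b3 y0 h Q \<eta>) (\<lambda>A. A \<in> so3) A) \<and>
    (\<forall>A. is_arg_min (hom_objective \<mu> Lc b1 b2 b3 y0 h Q \<eta>) (\<lambda>A. A \<in> so3) A \<longrightarrow>
       axl A = ((b2 - b1) / (b1 + b2)) *\<^sub>R (transpose K *v n0)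
             - ((2 * b3) / (2 * (b1 + b3)) * trace K) *\<^sub>R n0) \<and>
    W_curv_hom \<mu> Lc b1 b2 b3 y0 h Q \<eta> =
      \<mu> * Lc\<^sup>2 * (b1 * (norm (sym_part Kpar))\<^sup>2 + b2 * (norm (skew_part Kpar))\<^sup>2
        + (b1 * b3) / (b1 + b3) * (trace Kpar)\<^sup>2
        + (2 * b1 * b2) / (b1 + b2) * (norm Kperp)\<^sup>2) \<and>
    K = Kpar + Kperp \<and> Kpar \<bullet> Kperp = 0 \<and>
    (\<forall>v. Kpar *v v \<in> span {partial_deriv 1 y0 (proj12 \<eta>), partial_deriv 2 y0 (proj12 \<eta>)}) \<and>
    (\<forall>v. Kperp *v v \<in> span {n0})"
proof -
  define P where "P = dyad n0 (transpose K *v n0)"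
  have \<omega>: "open \<omega>"
    using \<open>bounded_Lipschitz_domain \<omega>\<close> by (simp add: bounded_Lipschitz_domain_def)
  note geom = \<omega> \<open>C2_on \<omega> y0\<close> \<open>h > 0\<close> \<open>C1_diffeomorphism_on (slab \<omega> h) (Theta y0)\<close>
  have x: "proj12 \<eta> \<in> \<omega>"
    using \<open>\<eta> \<in> slab \<omega> 1\<close> by (simp add: slab_def)
  have n: "norm n0 = 1"
    using unit_normal_properties(1) unit_normal_nonzero[OF _ \<open>h > 0\<close> x]
      \<open>C1_diffeomorphism_on (slab \<omega> h) (Theta y0)\<close>
    by (auto simp: n0_def C1_diffeomorphism_on_def)
  note A = tangential_projection[OF geom x, folded n0_def]
  note upd = curv_with_column_update[OF geom \<open>\<eta> \<in> slab \<omega> 1\<close>, where Q = Q, folded n0_def K_def]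
  have perp: "Kperp = P"
    by (simp add: Kperp_def K_perp_def A dyad_matrix_mult P_def K_def)
  have split: "K = Kpar + Kperp"
    by (simp add: Kperp_def K_perp_def Kpar_def K_par_def matrix_mult_add_left[symmetric] K_def)
  then have par: "Kpar = K - P"
    using perp by simp
  have kn: "K *v n0 = 0" by (rule upd(2))
  have obj: "hom_objective \<mu> Lc b1 b2 b3 y0 h Q \<eta> A =
      \<mu> * Lc\<^sup>2 * (b1 * (norm (sym_part Kpar))\<^sup>2 + b2 * (norm (skew_part Kpar))\<^sup>2
        + (b1 * b3) / (b1 + b3) * (trace Kpar)\<^sup>2 + (2 * b1 * b2) / (b1 + b2) * (norm Kperp)\<^sup>2)
      + \<mu> * Lc\<^sup>2 * excess b1 b2 b3 n0 (axl A - optimal_column b1 b2 b3 K n0)" for A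
    unfolding hom_objective_def upd(1) perp par P_def
    by (rule W_curv_completed_square[OF \<open>b1 > 0\<close> \<open>b2 > 0\<close> \<open>b3 > 0\<close> n kn])
  have E: "\<mu> * Lc\<^sup>2 * excess b1 b2 b3 n0 0 = 0"
    "\<And>d. d \<noteq> 0 \<Longrightarrow> \<mu> * Lc\<^sup>2 * excess b1 b2 b3 n0 d > 0"
    using excess_pos[OF \<open>b1 > 0\<close> \<open>b2 > 0\<close> \<open>b3 > 0\<close> n] \<open>\<mu> > 0\<close> \<open>Lc > 0\<close> by simp_all
  note min = arg_min_by_excess[where E = "\<lambda>d. \<mu> * Lc\<^sup>2 * excess b1 b2 b3 n0 d", OF axl_bij obj E]
  have orth: "Kpar \<bullet> Kperp = 0"
  proof -
    have nn: "n0 \<bullet> n0 = 1" using n by (simp add: norm_eq_1)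
    have "n0 \<bullet> (K *v (transpose K *v n0)) = (transpose K *v n0) \<bullet> (transpose K *v n0)"
      by (simp add: dot_lmul_matrix[symmetric] transpose_matrix_vector)
    then show ?thesis
      unfolding par perp P_def inner_diff_left unfolding inner_dyad dyad_vec by (simp add: nn)
  qed
  have tangential: "Kpar *v v \<in> span {partial_deriv 1 y0 (proj12 \<eta>), partial_deriv 2 y0 (proj12 \<eta>)}" for v
    unfolding Kpar_def K_par_def A_y0_def matrix_vector_mul_assoc[symmetric] cols3_vec
    by (simp add: span_add span_scale span_base)
  have normal: "Kperp *v v \<in> span {n0}" for v
    unfolding perp P_def by (simp add: span_scale span_base)
  show ?thesis
    unfolding W_curv_hom_def
    using min split orth tangential normal unfolding optimal_column_def by blast
qed

end
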